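(* Let $X$ be a finite-dimensional complex Banach space and let $T:X\to X$ be a diffeomorphism with fixed point $0$, having a power series around $0$, whose differential $T'(0)$ is diagonalizable with nonzero eigenvalues. Then the (unital) principle algebra satisfies $\mathcal A_{T'(0)}=\mathcal P(X;\mathbb C)$, the space of $\mathbb C$-valued polynomials on $X$.
   Context: Let $n=\dim X$, let $\{e_1,\dots,e_n\}$ be a basis of $X$ of eigenvectors of $T'(0)$, and let $\{\phi_1,\dots,\phi_n\}\subset X^*$ be the dual basis (the principle eigenfunctions of the Koopman operator $U_{T'(0)}f=f\circ T'(0)$). The principle algebra $\mathcal A_{T'(0)}$ is the complex subalgebra of $C(X)$ generated by $\phi_1,\dots,\phi_n$, here with the constant functions appended. A map $P:X\to\mathbb C$ is an $m$-homogeneous polynomial if $P(x)=A(x,\dots,x)$ for some $m$-linear form $A:X^m\to\mathbb C$ (constants for $m=0$); $\mathcal P(X;\mathbb C)$ is the algebraic direct sum over $m\in\mathbb N_0$ of the spaces of continuous $m$-homogeneous polynomials, i.e. finite sums of such. *)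

theory Defs
  imports "HOL-Analysis.Analysis"
begin

class scaleC = scaleR +
  fixes scaleC :: "complex \<Rightarrow> 'a \<Rightarrow> 'a" (infixr "*\<^sub>C" 75)
  assumes scaleR_scaleC: "scaleR r x = complex_of_real r *\<^sub>C x"

class complex_vector = real_vector + scaleC +
  assumes scaleC_add_right: "a *\<^sub>C (x + y) = a *\<^sub>C x + a *\<^sub>C y"
    and scaleC_add_left: "(a + b) *\<^sub>C x = a *\<^sub>C x + b *\<^sub>C x"
    and scaleC_scaleC: "a *\<^sub>C (b *\<^sub>C x) = (a * b) *\<^sub>C x"
    and scaleC_one: "1 *\<^sub>C x = x"

class complex_normed_vector = complex_vector + real_normed_vector +
  assumes norm_scaleC: "norm (a *\<^sub>C x) = cmod a * norm x"

class complex_banach = complex_normed_vector + banach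

instantiation complex :: complex_banach
begin

definition scaleC_complex :: "complex \<Rightarrow> complex \<Rightarrow> complex"
  where "scaleC_complex a x = a * x"

instance
  by standard (simp_all add: scaleC_complex_def scaleR_conv_of_real norm_mult algebra_simps)

end

global_interpretation complex_vector: vector_space "scaleC :: complex \<Rightarrow> 'a \<Rightarrow> 'a::complex_vector"
  by standard (simp_all add: scaleC_add_right scaleC_add_left scaleC_scaleC scaleC_one)

abbreviation clinear :: "('a::complex_vector \<Rightarrow> 'b::complex_vector) \<Rightarrow> bool"
  where "clinear \<equiv> Vector_Spaces.linear scaleC scaleC"

definition finite_dimensional :: "'a::complex_vector itself \<Rightarrow> bool"
  where "finite_dimensional _ \<longleftrightarrow>
    (\<exists>B::'a set. finite B \<and> complex_vector.span B = UNIV)"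

definition indexed_basis :: "nat \<Rightarrow> (nat \<Rightarrow> 'a::complex_vector) \<Rightarrow> bool"
  where "indexed_basis n e \<longleftrightarrow>
    inj_on e {1..n} \<and> complex_vector.independent (e ` {1..n}) \<and>
    complex_vector.span (e ` {1..n}) = UNIV"

definition topological_dual :: "('a::complex_normed_vector \<Rightarrow> complex) set"
  where "topological_dual = {\<phi>. clinear \<phi> \<and> continuous_on UNIV \<phi>}"

definition dual_basis ::
    "nat \<Rightarrow> (nat \<Rightarrow> 'a::complex_normed_vector) \<Rightarrow> (nat \<Rightarrow> 'a \<Rightarrow> complex) \<Rightarrow> bool"
  where "dual_basis n e \<phi> \<longleftrightarrow>
    (\<forall>i\<in>{1..n}. \<phi> i \<in> topological_dual \<and>
      (\<forall>j\<in>{1..n}. \<phi> i (e j) = (if i = j then 1 else 0)))"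

definition eigenvector :: "('a::complex_vector \<Rightarrow> 'a) \<Rightarrow> complex \<Rightarrow> 'a \<Rightarrow> bool"
  where "eigenvector D c v \<longleftrightarrow> v \<noteq> 0 \<and> D v = c *\<^sub>C v"

definition eigenvalue :: "('a::complex_vector \<Rightarrow> 'a) \<Rightarrow> complex \<Rightarrow> bool"
  where "eigenvalue D c \<longleftrightarrow> (\<exists>v. eigenvector D c v)"

definition diagonalizable :: "('a::complex_vector \<Rightarrow> 'a) \<Rightarrow> bool"
  where "diagonalizable D \<longleftrightarrow>
    (\<exists>B. complex_vector.independent B \<and> complex_vector.span B = UNIV \<and>
      (\<forall>b\<in>B. \<exists>c. eigenvector D c b))"

text \<open>A point of \<open>X\<^sup>m\<close> is a list of length \<open>m\<close>; values of \<open>A\<close> on other lists are irrelevant.\<close>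

definition multilinear ::
    "nat \<Rightarrow> ('a::complex_vector list \<Rightarrow> 'b::complex_vector) \<Rightarrow> bool"
  where "multilinear m A \<longleftrightarrow>
    (\<forall>xs i. length xs = m \<longrightarrow> i < m \<longrightarrow> clinear (\<lambda>y. A (xs[i := y])))"

definition homogeneous_polynomial ::
    "nat \<Rightarrow> ('a::complex_vector \<Rightarrow> 'b::complex_vector) \<Rightarrow> bool"
  where "homogeneous_polynomial m P \<longleftrightarrow>
    (\<exists>A. multilinear m A \<and> (\<forall>x. P x = A (replicate m x)))"

definition continuous_homogeneous_polynomials ::
    "nat \<Rightarrow> ('a::complex_normed_vector \<Rightarrow> 'b::complex_normed_vector) set"
  where "continuous_homogeneous_polynomials m =
    {P. homogeneous_polynomial m P \<and> continuous_on UNIV P}"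

definition polynomials :: "('a::complex_normed_vector \<Rightarrow> complex) set"
  where "polynomials =
    {f. \<exists>N P. (\<forall>m\<le>N. P m \<in> continuous_homogeneous_polynomials m) \<and>
      f = (\<lambda>x. \<Sum>m\<le>N. P m x)}"

definition has_power_series_around ::
    "('a::complex_normed_vector \<Rightarrow> 'b::complex_normed_vector) \<Rightarrow> 'a \<Rightarrow> bool"
  where "has_power_series_around f a \<longleftrightarrow>
    (\<exists>P r. r > 0 \<and> (\<forall>m. P m \<in> continuous_homogeneous_polynomials m) \<and>
      uniform_limit (ball a r) (\<lambda>N x. \<Sum>m<N. P m (x - a)) f sequentially)"

text \<open>Differentiability is over the complex numbers: the Frechet derivative, which the library
  takes over the reals, is required to be complex linear. Continuity of the derivative refers
  to the operator norm.\<close>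

definition continuously_complex_differentiable ::
    "('a::complex_normed_vector \<Rightarrow> 'b::complex_normed_vector) \<Rightarrow> bool"
  where "continuously_complex_differentiable f \<longleftrightarrow>
    (\<exists>F :: 'a \<Rightarrow> 'a \<Rightarrow>\<^sub>L 'b.
      (\<forall>x. (f has_derivative blinfun_apply (F x)) (at x) \<and> clinear (blinfun_apply (F x))) \<and>
      continuous_on UNIV F)"

definition diffeomorphism :: "('a::complex_normed_vector \<Rightarrow> 'a) \<Rightarrow> bool"
  where "diffeomorphism T \<longleftrightarrow>
    bij T \<and> continuously_complex_differentiable T \<and>
    continuously_complex_differentiable (inv T)"

text \<open>Subalgebras of \<open>C(X)\<close>; they need not contain the constants.\<close>

definition complex_subalgebra :: "('a::topological_space \<Rightarrow> complex) set \<Rightarrow> bool"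
  where "complex_subalgebra \<A> \<longleftrightarrow>
    \<A> \<subseteq> {f. continuous_on UNIV f} \<and>
    (\<lambda>x. 0) \<in> \<A> \<and>
    (\<forall>f\<in>\<A>. \<forall>g\<in>\<A>. (\<lambda>x. f x + g x) \<in> \<A>) \<and>
    (\<forall>c. \<forall>f\<in>\<A>. (\<lambda>x. c * f x) \<in> \<A>) \<and>
    (\<forall>f\<in>\<A>. \<forall>g\<in>\<A>. (\<lambda>x. f x * g x) \<in> \<A>)"

definition generated_algebra ::
    "('a::topological_space \<Rightarrow> complex) set \<Rightarrow> ('a \<Rightarrow> complex) set"
  where "generated_algebra S = \<Inter>{\<A>. complex_subalgebra \<A> \<and> S \<subseteq> \<A>}"

definition unital_principle_algebra ::
    "nat \<Rightarrow> (nat \<Rightarrow> 'a::topological_space \<Rightarrow> complex) \<Rightarrow> ('a \<Rightarrow> complex) set"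
  where "unital_principle_algebra n \<phi> =
    generated_algebra (\<phi> ` {1..n} \<union> range (\<lambda>c x. c))"

end

theory Submission
  imports Defs
begin

text \<open>Polynomials form a unital subalgebra of \<open>C(X)\<close> containing the linear functionals \<open>\<phi> i\<close>.
  Conversely, substituting \<open>x = (\<Sum>i. \<phi> i x e i)\<close> into the arguments of a multilinear form one at a
  time writes \<open>A (x, \<dots>, x)\<close> as a polynomial expression in the \<open>\<phi> i x\<close>.\<close>

section \<open>Coordinates with respect to a dual basis\<close>

lemma clinear_iff:
  "clinear f \<longleftrightarrow> (\<forall>x y. f (x + y) = f x + f y) \<and> (\<forall>c x. f (c *\<^sub>C x) = c *\<^sub>C f x)"
  by (auto simp: Vector_Spaces.linear_iff complex_vector.vector_space_axioms)

lemma clinear_sum_scaleC: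
  assumes "clinear f"
  shows "f (\<Sum>i\<in>I. c i *\<^sub>C v i) = (\<Sum>i\<in>I. c i *\<^sub>C f (v i))"
proof -
  interpret f: Vector_Spaces.linear scaleC scaleC f by (fact assms)
  show ?thesis by (simp add: f.sum f.scale)
qed

text \<open>Both sides are linear in \<open>x\<close> and agree on each \<open>e j\<close>, and
  these vectors span the space. This is the substitution later made in every argument of a
  multilinear form.\<close>

lemma dual_basis_expansion:
  assumes e: "indexed_basis n e" and \<phi>: "dual_basis n e \<phi>"
  shows "x = (\<Sum>i\<in>{1..n}. \<phi> i x *\<^sub>C e i)"
proof -
  have lin: "clinear (\<phi> i)" if "i \<in> {1..n}" for i
    using \<phi> that by (auto simp: dual_basis_def topological_dual_def)
  have zero: "\<phi> i 0 = 0" if "i \<in> {1..n}" for i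
    \<comment> \<open>Over the empty index set both sums vanish, so this instance reads
      \<open>\<phi> i 0 = 0\<close>.\<close>
    using clinear_sum_scaleC[OF lin[OF that], of "\<lambda>_. 0" "\<lambda>_. 0" "{}"] by simp
  have "x \<in> complex_vector.span (e ` {1..n})"
    using e by (simp add: indexed_basis_def)
  then show ?thesis
  proof (induction rule: complex_vector.span_induct_alt)
    case base
    show ?case by (simp add: zero)
  next
    case (step c b y)
    then obtain j where j: "j \<in> {1..n}" "b = e j" by blast
    \<comment> \<open>By duality, adding \<open>c\<close> times \<open>e j\<close> changes only the
      \<open>j\<close>-th coordinate, and changes it by \<open>c\<close>.\<close>
    have "(\<Sum>i\<in>{1..n}. \<phi> i (c *\<^sub>C b + y) *\<^sub>C e i)
        = (\<Sum>i\<in>{1..n}. (if i = j then c *\<^sub>C e j else 0) + \<phi> i y *\<^sub>C e i)"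
    proof (rule sum.cong)
      fix i assume i: "i \<in> {1..n}"
      have "\<phi> i (c *\<^sub>C b + y) = c * (if i = j then 1 else 0) + \<phi> i y"
        using lin[OF i] \<phi> i j by (simp add: clinear_iff dual_basis_def scaleC_complex_def)
      then show "\<phi> i (c *\<^sub>C b + y) *\<^sub>C e i
          = (if i = j then c *\<^sub>C e j else 0) + \<phi> i y *\<^sub>C e i"
        by (simp add: scaleC_add_left)
    qed simp
    also have "\<dots> = c *\<^sub>C b + y"
      using j step.IH by (simp add: sum.distrib)
    finally show ?case by simp
  qed
qed

section \<open>Polynomials belong to the generated algebra\<close>

lemma complex_subalgebra_sum:
  assumes "complex_subalgebra \<A>" "\<And>i. i \<in> I \<Longrightarrow> f i \<in> \<A>"
  shows "(\<lambda>x. \<Sum>i\<in>I. f i x) \<in> \<A>"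
  \<comment> \<open>A sum over an infinite \<open>I\<close> is 0 by convention, and the zero
    function lies in every subalgebra.\<close>
  using assms by (induction I rule: infinite_finite_induct) (auto simp: complex_subalgebra_def)

text \<open>Letting \<open>\<A>\<close> be any subalgebra with these generators makes the result
  apply to each member of the intersection that defines the generated algebra.\<close>

lemma homogeneous_polynomial_in_subalgebra:
  assumes \<A>: "complex_subalgebra \<A>" "\<And>i. i \<in> {1..n} \<Longrightarrow> \<phi> i \<in> \<A>" "\<And>c. (\<lambda>x. c) \<in> \<A>"
    and basis: "indexed_basis n e" "dual_basis n e \<phi>"
    and P: "homogeneous_polynomial m P"
  shows "P \<in> \<A>"
proof -
  obtain A where A: "multilinear m A" and PA: "\<And>x. P x = A (replicate m x)"
    using P by (auto simp: homogeneous_polynomial_def)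
  \<comment> \<open>Generalization for induction on \<open>k\<close>, the number of arguments still
    equal to \<open>x\<close>. The list \<open>ys\<close> of fixed vectors is arbitrary, since each
    step puts some \<open>e i\<close> in front of it; at \<open>k = 0\<close> the function is
    constant.\<close>
  have "(\<lambda>x. A (replicate k x @ ys)) \<in> \<A>" if "k + length ys = m" for k ys
    using that
  proof (induction k arbitrary: ys)
    case 0
    show ?case using \<A>(3) by simp
  next
    case (Suc k)
    have "A (replicate (Suc k) x @ ys) = (\<Sum>i\<in>{1..n}. \<phi> i x * A (replicate k x @ e i # ys))"
      for x
    proof -
      \<comment> \<open>Only slot \<open>k\<close>, the last one holding \<open>x\<close>, is
        varied; the other copies of \<open>x\<close> stay frozen, so the expression is linear in
        \<open>y\<close>.\<close>
      have "clinear (\<lambda>y. A ((replicate k x @ x # ys)[k := y]))"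
        using A Suc.prems by (auto simp: multilinear_def)
      then have lin: "clinear (\<lambda>y. A (replicate k x @ y # ys))"
        by (simp add: list_update_append)
      have "A (replicate (Suc k) x @ ys) = A (replicate k x @ x # ys)"
        by (simp add: replicate_app_Cons_same)
      also have "\<dots> = A (replicate k x @ (\<Sum>i\<in>{1..n}. \<phi> i x *\<^sub>C e i) # ys)"
        using dual_basis_expansion[OF basis, of x] by simp
      also have "\<dots> = (\<Sum>i\<in>{1..n}. \<phi> i x * A (replicate k x @ e i # ys))"
        using clinear_sum_scaleC[OF lin] by (simp add: scaleC_complex_def)
      finally show ?thesis .
    qed
    moreover have "(\<lambda>x. \<Sum>i\<in>{1..n}. \<phi> i x * A (replicate k x @ e i # ys)) \<in> \<A>"
    proof (rule complex_subalgebra_sum[OF \<A>(1)])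
      fix i assume "i \<in> {1..n}"
      moreover have "(\<lambda>x. A (replicate k x @ e i # ys)) \<in> \<A>"
        using Suc.IH[of "e i # ys"] Suc.prems by simp
      ultimately show "(\<lambda>x. \<phi> i x * A (replicate k x @ e i # ys)) \<in> \<A>"
        using \<A>(1,2) by (simp add: complex_subalgebra_def)
    qed
    ultimately show ?case by presburger
  qed
  from this[of m "[]"] show ?thesis by (simp add: PA[symmetric])
qed

section \<open>Operations on multilinear forms and homogeneous polynomials\<close>

lemma multilinear_zero: "multilinear m (\<lambda>xs. 0)"
  by (simp add: multilinear_def clinear_iff)

lemma multilinear_add:
  "multilinear m A \<Longrightarrow> multilinear m B \<Longrightarrow> multilinear m (\<lambda>xs. A xs + B xs)"
  by (simp add: multilinear_def clinear_iff scaleC_add_right)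

text \<open>Each slot belongs to exactly one of the two blocks, so varying it moves one factor
  linearly and leaves the other constant.\<close>

lemma multilinear_mult:
  fixes A B :: "'a::complex_vector list \<Rightarrow> complex"
  assumes A: "multilinear m A" and B: "multilinear k B"
  shows "multilinear (m + k) (\<lambda>xs. A (take m xs) * B (drop m xs))"
  unfolding multilinear_def
proof (intro allI impI)
  fix xs :: "'a list" and i
  assume xs: "length xs = m + k" and i: "i < m + k"
  show "clinear (\<lambda>y. A (take m (xs[i := y])) * B (drop m (xs[i := y])))"
  proof (cases "i < m")
    case True
    then have "clinear (\<lambda>y. A ((take m xs)[i := y]))"
      using A xs by (simp add: multilinear_def)
    then show ?thesis
      using True by (simp add: take_update_swap clinear_iff scaleC_complex_def algebra_simps)
  next
    case False
    then have "clinear (\<lambda>y. B ((drop m xs)[i - m := y]))"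
      using B xs i by (simp add: multilinear_def)
    then show ?thesis
      using False by (simp add: drop_update_swap clinear_iff scaleC_complex_def algebra_simps)
  qed
qed

lemma continuous_homogeneous_polynomials_zero:
  "(\<lambda>x. 0) \<in> continuous_homogeneous_polynomials m"
  using multilinear_zero by (auto simp: continuous_homogeneous_polynomials_def homogeneous_polynomial_def)

lemma continuous_homogeneous_polynomials_const:
  "(\<lambda>x. c) \<in> continuous_homogeneous_polynomials 0"
  \<comment> \<open>A form of degree 0 has no slot to vary, so multilinearity of the constant form
    is vacuous.\<close>
  by (auto simp: continuous_homogeneous_polynomials_def homogeneous_polynomial_def
      multilinear_def intro: exI[of _ "\<lambda>_. c"])

lemma continuous_homogeneous_polynomials_linear:
  assumes "\<phi> \<in> topological_dual"
  shows "\<phi> \<in> continuous_homogeneous_polynomials 1"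
proof -
  have "multilinear 1 (\<lambda>xs. \<phi> (hd xs))"
    using assms by (auto simp: multilinear_def topological_dual_def length_Suc_conv)
  then show ?thesis
    using assms by (auto simp: continuous_homogeneous_polynomials_def
        homogeneous_polynomial_def topological_dual_def intro!: exI[of _ "\<lambda>xs. \<phi> (hd xs)"])
qed

lemma continuous_homogeneous_polynomials_add:
  assumes "P \<in> continuous_homogeneous_polynomials m" "Q \<in> continuous_homogeneous_polynomials m"
  shows "(\<lambda>x. P x + Q x) \<in> continuous_homogeneous_polynomials m"
proof -
  obtain A B where "multilinear m A" "\<forall>x. P x = A (replicate m x)"
    "multilinear m B" "\<forall>x. Q x = B (replicate m x)"
    using assms by (auto simp: continuous_homogeneous_polynomials_def homogeneous_polynomial_def)
  then have "homogeneous_polynomial m (\<lambda>x. P x + Q x)"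
    unfolding homogeneous_polynomial_def
    by (intro exI[of _ "\<lambda>xs. A xs + B xs"]) (simp add: multilinear_add)
  then show ?thesis
    using assms by (auto simp: continuous_homogeneous_polynomials_def intro: continuous_on_add)
qed

lemma continuous_homogeneous_polynomials_mult:
  fixes P Q :: "'a::complex_normed_vector \<Rightarrow> complex"
  assumes "P \<in> continuous_homogeneous_polynomials m" "Q \<in> continuous_homogeneous_polynomials k"
  shows "(\<lambda>x. P x * Q x) \<in> continuous_homogeneous_polynomials (m + k)"
proof -
  obtain A B where "multilinear m A" "\<forall>x. P x = A (replicate m x)"
    "multilinear k B" "\<forall>x. Q x = B (replicate k x)"
    using assms by (auto simp: continuous_homogeneous_polynomials_def homogeneous_polynomial_def)
  then have "homogeneous_polynomial (m + k) (\<lambda>x. P x * Q x)"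
    unfolding homogeneous_polynomial_def
    by (intro exI[of _ "\<lambda>xs. A (take m xs) * B (drop m xs)"]) (simp add: multilinear_mult)
  then show ?thesis
    using assms by (auto simp: continuous_homogeneous_polynomials_def intro: continuous_on_mult)
qed

section \<open>Polynomials form a subalgebra\<close>

lemma homogeneous_in_polynomials:
  assumes "P \<in> continuous_homogeneous_polynomials m"
  shows "P \<in> polynomials"
proof -
  \<comment> \<open>The degrees below \<open>m\<close> are filled with the zero polynomial, which is
    homogeneous of every degree.\<close>
  have "P = (\<lambda>x. \<Sum>i\<le>m. (if i = m then P else (\<lambda>x. 0)) x)"
    by (simp add: fun_eq_iff if_distrib[of "\<lambda>f. f _"])
  then show ?thesis
    unfolding polynomials_def using assms continuous_homogeneous_polynomials_zero
    by (intro CollectI exI[of _ m] exI[of _ "\<lambda>i. if i = m then P else (\<lambda>x. 0)"]) auto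
qed

text \<open>The two degree bounds may differ, so both families are padded with zeros up to the
  larger bound and then added degree by degree.\<close>

lemma polynomials_add:
  assumes "f \<in> polynomials" "g \<in> polynomials"
  shows "(\<lambda>x. f x + g x) \<in> polynomials"
proof -
  obtain M P where P: "\<And>m. m \<le> M \<Longrightarrow> P m \<in> continuous_homogeneous_polynomials m"
    and f: "f = (\<lambda>x. \<Sum>m\<le>M. P m x)"
    using assms(1) by (auto simp: polynomials_def)
  obtain N Q where Q: "\<And>m. m \<le> N \<Longrightarrow> Q m \<in> continuous_homogeneous_polynomials m"
    and g: "g = (\<lambda>x. \<Sum>m\<le>N. Q m x)"
    using assms(2) by (auto simp: polynomials_def)
  let ?P = "\<lambda>m x. if m \<le> M then P m x else 0"
  let ?Q = "\<lambda>m x. if m \<le> N then Q m x else 0"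
  have "(\<Sum>m\<le>M. P m x) = (\<Sum>m\<le>max M N. ?P m x)" for x
    by (rule sum.mono_neutral_cong_left) auto
  moreover have "(\<Sum>m\<le>N. Q m x) = (\<Sum>m\<le>max M N. ?Q m x)" for x
    by (rule sum.mono_neutral_cong_left) auto
  ultimately have "(\<lambda>x. f x + g x) = (\<lambda>x. \<Sum>m\<le>max M N. ?P m x + ?Q m x)"
    by (simp add: f g sum.distrib)
  moreover have "?P m \<in> continuous_homogeneous_polynomials m" for m
    using P[of m] continuous_homogeneous_polynomials_zero by (cases "m \<le> M") simp_all
  moreover have "?Q m \<in> continuous_homogeneous_polynomials m" for m
    using Q[of m] continuous_homogeneous_polynomials_zero by (cases "m \<le> N") simp_all
  ultimately show ?thesis
    unfolding polynomials_def
    by (intro CollectI exI[of _ "max M N"] exI[of _ "\<lambda>m x. ?P m x + ?Q m x"])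
      (auto intro!: continuous_homogeneous_polynomials_add)
qed

lemma polynomials_sum:
  assumes "\<And>i. i \<in> I \<Longrightarrow> f i \<in> polynomials"
  shows "(\<lambda>x. \<Sum>i\<in>I. f i x) \<in> polynomials"
  using assms
  by (induction I rule: infinite_finite_induct)
    (simp_all add: homogeneous_in_polynomials[OF continuous_homogeneous_polynomials_zero]
      polynomials_add)

text \<open>The product expands into a double sum whose terms are homogeneous of degree
  \<open>m + k\<close>. Closure under sums makes it unnecessary to collect terms of equal
  degree.\<close>

lemma polynomials_mult:
  assumes "f \<in> polynomials" "g \<in> polynomials"
  shows "(\<lambda>x. f x * g x) \<in> polynomials"
proof -
  obtain M P where P: "\<And>m. m \<le> M \<Longrightarrow> P m \<in> continuous_homogeneous_polynomials m"
    and f: "f = (\<lambda>x. \<Sum>m\<le>M. P m x)"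
    using assms(1) by (auto simp: polynomials_def)
  obtain N Q where Q: "\<And>m. m \<le> N \<Longrightarrow> Q m \<in> continuous_homogeneous_polynomials m"
    and g: "g = (\<lambda>x. \<Sum>m\<le>N. Q m x)"
    using assms(2) by (auto simp: polynomials_def)
  have "(\<lambda>x. \<Sum>m\<le>M. \<Sum>k\<le>N. P m x * Q k x) \<in> polynomials"
    by (intro polynomials_sum homogeneous_in_polynomials[OF continuous_homogeneous_polynomials_mult[OF P Q]])
      auto
  then show ?thesis by (simp add: f g sum_product)
qed

lemma complex_subalgebra_polynomials: "complex_subalgebra polynomials"
  unfolding complex_subalgebra_def
proof (intro conjI ballI allI)
  show "(polynomials :: ('a \<Rightarrow> complex) set) \<subseteq> {f. continuous_on UNIV f}"
    by (auto simp: polynomials_def continuous_homogeneous_polynomials_def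
        intro!: continuous_on_sum)
  show "(\<lambda>x. 0) \<in> polynomials"
    by (rule homogeneous_in_polynomials[OF continuous_homogeneous_polynomials_zero])
qed (auto intro: polynomials_add polynomials_mult
    homogeneous_in_polynomials[OF continuous_homogeneous_polynomials_const])

theorem mainTheorem6:
  fixes T D :: "'a::complex_banach \<Rightarrow> 'a"
    and n :: nat
    and e :: "nat \<Rightarrow> 'a"
    and \<phi> :: "nat \<Rightarrow> 'a \<Rightarrow> complex"
  assumes "finite_dimensional TYPE('a)"
    and "n = complex_vector.dim (UNIV :: 'a set)"
    and "diffeomorphism T"
    and "T 0 = 0"
    and "has_power_series_around T 0"
    and "(T has_derivative D) (at 0)"
    and "diagonalizable D"
    and "\<forall>c. eigenvalue D c \<longrightarrow> c \<noteq> 0"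
    and "indexed_basis n e"
    and "\<forall>i\<in>{1..n}. \<exists>c. eigenvector D c (e i)"
    and "dual_basis n e \<phi>"
  shows "unital_principle_algebra n \<phi> = polynomials"
proof
  \<comment> \<open>Constants are homogeneous of degree 0 and the \<open>\<phi> i\<close> of degree
    1, so \<open>polynomials\<close> is one of the subalgebras being intersected.\<close>
  have "\<phi> ` {1..n} \<union> range (\<lambda>c x. c) \<subseteq> polynomials"
    using assms(11)
    by (auto simp: dual_basis_def intro: homogeneous_in_polynomials
        continuous_homogeneous_polynomials_const continuous_homogeneous_polynomials_linear)
  then show "unital_principle_algebra n \<phi> \<subseteq> polynomials"
    unfolding unital_principle_algebra_def generated_algebra_def
    using complex_subalgebra_polynomials by blast
next
  show "polynomials \<subseteq> unital_principle_algebra n \<phi>"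
    unfolding unital_principle_algebra_def generated_algebra_def
  \<comment> \<open>Membership in the intersection is checked in one arbitrary subalgebra
    \<open>\<A>\<close> containing the generators, one homogeneous summand at a time.\<close>
  proof (intro subsetI InterI)
    fix f :: "'a \<Rightarrow> complex" and \<A>
    assume f: "f \<in> polynomials"
      and "\<A> \<in> {\<A>. complex_subalgebra \<A> \<and> \<phi> ` {1..n} \<union> range (\<lambda>c x. c) \<subseteq> \<A>}"
    then have \<A>: "complex_subalgebra \<A>" "\<And>i. i \<in> {1..n} \<Longrightarrow> \<phi> i \<in> \<A>" "\<And>c. (\<lambda>x. c) \<in> \<A>"
      by auto
    obtain N P where "\<And>m. m \<le> N \<Longrightarrow> homogeneous_polynomial m (P m)"
      and "f = (\<lambda>x. \<Sum>m\<le>N. P m x)"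
      using f by (auto simp: polynomials_def continuous_homogeneous_polynomials_def)
    then show "f \<in> \<A>"
      using homogeneous_polynomial_in_subalgebra[OF \<A> assms(9,11)]
      by (auto intro!: complex_subalgebra_sum[OF \<A>(1)])
  qed
qed

end
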